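(* Let $X$ be a $T_0$ topological space and let $\gamma:I_{ir}\to X$ be an ir-path. Then $\gamma$ does not have a reverse ir-path.
   Context: $I_{ir}$ denotes the set $[0,1]$ with the left order topology, whose open sets are exactly $[0,b)$ for $0\le b\le 1$ (including $\emptyset$) and $[0,1]$. An ir-path in a topological space $X$ is a continuous map $\gamma:I_{ir}\to X$. If $\gamma$ is an ir-path with $\gamma(0)=x_0$ and $\gamma(1)=x_1$, a reverse ir-path of $\gamma$ is an ir-path $\overline{\gamma}:I_{ir}\to X$ with $\overline{\gamma}(0)=x_1$ and $\overline{\gamma}(1)=x_0$.
   Formalization: The ir-path γ is additionally assumed to be nonconstant on [0,1]; the claim as worded fails for every constant ir-path, which is its own reverse ir-path. *)

theory Defs
  imports "HOL-Analysis.Analysis"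
begin

definition I_ir :: "real topology" where
  "I_ir = topology (\<lambda>U. U = {0..1} \<or> (\<exists>b. 0 \<le> b \<and> b \<le> 1 \<and> U = {0..<b}))"

(* "topology" is unspecified outside "istopology", so this is what gives I_ir its meaning. *)
lemma istopology_I_ir:
  "istopology (\<lambda>U::real set. U = {0..1} \<or> (\<exists>b. 0 \<le> b \<and> b \<le> 1 \<and> U = {0..<b}))"
  (is "istopology ?P")
  unfolding istopology_def
proof (intro conjI allI impI)
  fix S T :: "real set"
  assume ST: "?P S" "?P T"
  have initial: "{0..1} \<inter> {0..<b} = {0..<b}" "{0..<b} \<inter> {0..1} = {0..<b}"
    if "b \<le> 1" for b :: real
    using that by auto
  have meet: "{0..<b} \<inter> {0..<c} = {0..<min b c}" for b c :: real
    by auto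
  from ST show "?P (S \<inter> T)"
  proof (elim disjE exE conjE)
    fix b c :: real
    assume "0 \<le> b" "b \<le> 1" "S = {0..<b}" "0 \<le> c" "c \<le> 1" "T = {0..<c}"
    then show "?P (S \<inter> T)"
      by (intro disjI2 exI[of _ "min b c"]) (simp add: meet)
  next
    fix b :: real
    assume "S = {0..1}" "0 \<le> b" "b \<le> 1" "T = {0..<b}"
    then show "?P (S \<inter> T)"
      by (intro disjI2 exI[of _ b]) (simp add: initial)
  next
    fix b :: real
    assume "0 \<le> b" "b \<le> 1" "S = {0..<b}" "T = {0..1}"
    then show "?P (S \<inter> T)"
      by (intro disjI2 exI[of _ b]) (simp add: initial)
  qed simp
next
  fix K :: "real set set"
  assume K: "\<forall>S\<in>K. ?P S"
  show "?P (\<Union>K)"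
  proof (cases "{0..1} \<in> K")
    case True
    have "S \<subseteq> {0..1}" if "S \<in> K" for S
      using K that by force
    with True have "\<Union>K = {0..1}"
      by blast
    then show ?thesis by blast
  next
    case False
    define B where "B = insert 0 {b. 0 \<le> b \<and> b \<le> 1 \<and> {0..<b} \<in> K}"
    have bdd: "bdd_above B" and ne: "B \<noteq> {}"
      by (auto simp: B_def intro!: bdd_aboveI[of _ 1])
    have "0 \<le> Sup B"
      by (rule cSup_upper[OF _ bdd]) (simp add: B_def)
    moreover have "Sup B \<le> 1"
      by (rule cSup_least[OF ne]) (auto simp: B_def)
    moreover have "\<Union>K = {0..<Sup B}"
    proof (intro equalityI subsetI)
      fix x assume "x \<in> \<Union>K"
      then obtain S where "S \<in> K" "x \<in> S" by blast
      then obtain b where "0 \<le> b" "b \<le> 1" "S = {0..<b}"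
        using K False by metis
      with \<open>S \<in> K\<close> have "b \<in> B" by (simp add: B_def)
      then have "b \<le> Sup B" by (rule cSup_upper[OF _ bdd])
      with \<open>x \<in> S\<close> \<open>S = {0..<b}\<close> show "x \<in> {0..<Sup B}" by simp
    next
      fix x assume x: "x \<in> {0..<Sup B}"
      then obtain b where "b \<in> B" "x < b"
        using less_cSup_iff[OF ne bdd] by auto
      with x have "0 < b" by simp
      with \<open>b \<in> B\<close> have "{0..<b} \<in> K" by (simp add: B_def)
      moreover have "x \<in> {0..<b}" using x \<open>x < b\<close> by simp
      ultimately show "x \<in> \<Union>K" by blast
    qed
    ultimately show ?thesis by blast
  qed
qed

lemma openin_I_ir:
  "openin I_ir U \<longleftrightarrow> U = {0..1} \<or> (\<exists>b. 0 \<le> b \<and> b \<le> 1 \<and> U = {0..<b})"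
  by (simp add: I_ir_def topology_inverse'[OF istopology_I_ir])

lemma topspace_I_ir: "topspace I_ir = {0..1}"
proof
  have "U \<subseteq> {0..1}" if "openin I_ir U" for U
    using that unfolding openin_I_ir by force
  then show "topspace I_ir \<subseteq> {0..1}"
    by simp
  show "{0..1} \<subseteq> topspace I_ir"
    by (rule openin_subset) (simp add: openin_I_ir)
qed

definition ir_path :: "'a topology \<Rightarrow> (real \<Rightarrow> 'a) \<Rightarrow> bool" where
  "ir_path X \<gamma> \<longleftrightarrow> continuous_map I_ir X \<gamma>"

definition reverse_ir_path :: "'a topology \<Rightarrow> (real \<Rightarrow> 'a) \<Rightarrow> (real \<Rightarrow> 'a) \<Rightarrow> bool" where
  "reverse_ir_path X \<gamma> \<gamma>' \<longleftrightarrow> ir_path X \<gamma>' \<and> \<gamma>' 0 = \<gamma> 1 \<and> \<gamma>' 1 = \<gamma> 0"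

end

theory Submission
  imports Defs
begin

text \<open>Along an ir-path every open set of X is met in an initial segment, so each point
  specializes to all earlier ones. If a reverse path exists, the two endpoints specialize to each
  other, hence so do all points of the path; in a T0 space the path is then constant.\<close>

lemma openin_I_ir_downward:
  assumes "openin I_ir U" "t \<in> U" "0 \<le> s" "s \<le> t"
  shows "s \<in> U"
  using assms by (auto simp: openin_I_ir)

text \<open>The preimage of \<open>U\<close> is open in \<open>I_ir\<close>, hence an initial
  segment. The bounds keep \<open>s\<close> and \<open>t\<close> in [0,1], since continuity says
  nothing about \<open>\<gamma>\<close> elsewhere.\<close>

lemma ir_path_openin_downward:
  assumes "ir_path X \<gamma>" "openin X U" "\<gamma> t \<in> U" "0 \<le> s" "s \<le> t" "t \<le> 1"
  shows "\<gamma> s \<in> U"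
proof -
  have "openin I_ir {x \<in> topspace I_ir. \<gamma> x \<in> U}"
    using assms(1,2) unfolding ir_path_def by (rule openin_continuous_map_preimage)
  then have "s \<in> {x \<in> topspace I_ir. \<gamma> x \<in> U}"
    by (rule openin_I_ir_downward[of _ t]) (use assms in \<open>auto simp: topspace_I_ir\<close>)
  then show ?thesis by simp
qed

text \<open>A path constant on [0,1] is its own reverse, so the claim concerns non-constant
  paths.\<close>

theorem theorem11:
  fixes X :: "'a topology" and \<gamma> :: "real \<Rightarrow> 'a"
  assumes "t0_space X" and "ir_path X \<gamma>" and "\<not> \<gamma> constant_on topspace I_ir"
  shows "\<not> (\<exists>\<gamma>'. reverse_ir_path X \<gamma> \<gamma>')"
proof
  assume "\<exists>\<gamma>'. reverse_ir_path X \<gamma> \<gamma>'"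
  then obtain \<gamma>' where \<gamma>': "ir_path X \<gamma>'" "\<gamma>' 0 = \<gamma> 1" "\<gamma>' 1 = \<gamma> 0"
    by (auto simp: reverse_ir_path_def)
  have "\<gamma> t = \<gamma> 0" if t: "t \<in> {0..1}" for t
  proof -
    have "\<gamma> t \<in> U \<longleftrightarrow> \<gamma> 0 \<in> U" if U: "openin X U" for U
    proof
      assume "\<gamma> t \<in> U"
      then show "\<gamma> 0 \<in> U"
        using ir_path_openin_downward[OF assms(2) U, of t 0] t by simp
    next
      assume "\<gamma> 0 \<in> U"
      \<comment> \<open>Going down from 1 to 0 along \<open>\<gamma>'\<close> leads from
        \<open>\<gamma> 0\<close> to \<open>\<gamma> 1\<close>, the direction that
        \<open>\<gamma>\<close> itself does not give.\<close>
      then have "\<gamma> 1 \<in> U"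
        using ir_path_openin_downward[OF \<gamma>'(1) U, of 1 0] \<gamma>' by simp
      then show "\<gamma> t \<in> U"
        using ir_path_openin_downward[OF assms(2) U, of 1 t] t by simp
    qed
    \<comment> \<open>The T0 axiom separates only points of \<open>topspace X\<close>.\<close>
    moreover have "\<gamma> t \<in> topspace X" "\<gamma> 0 \<in> topspace X"
      using assms(2) t by (auto simp: ir_path_def continuous_map_def topspace_I_ir)
    ultimately show ?thesis
      using assms(1) unfolding t0_space_def by blast
  qed
  then have "\<gamma> constant_on topspace I_ir"
    unfolding constant_on_def topspace_I_ir by blast
  with assms(3) show False ..
qed

end
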